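(* Let $0<r_\alpha\le r_\beta$ and $0<\theta_\alpha<\theta_\beta<2\pi$, and let $(x,y)\ne(0,0)$ be reachable, i.e. there exist $r\in[r_\alpha,r_\beta]$, $\theta_c\in[\theta_\alpha,\theta_\beta]$ and $d>0$ with $H_{r,\theta_c}(d)=(x,y)$. Let $d_{\min}(x,y)$ be the infimum of all such $d$. Then: (i) if $\theta_\alpha\le\Theta(x,y,r_\alpha)\le\theta_\beta$, then $d_{\min}(x,y)=L(x,y,\Theta(x,y,r_\alpha),r_\alpha)$; (ii) if $\Big(\big(x^2+y^2>2r_\alpha y\land 0\le y\land(r_\alpha\le r_m\lor y=0)\land\theta_\alpha<\theta_m\big)\lor\big(y<0\land\theta_m<0\big)\Big)\land\Theta(x,y,r_\alpha)<\theta_\alpha$, then $d_{\min}(x,y)=L(x,y,\theta_\alpha,R(x,y,\theta_\alpha))$; (iii) if $r_\alpha\le r_m\le r_\beta$ and $\theta_m\le\max(\theta_\alpha,\Theta(x,y,r_\alpha))$, then $d_{\min}(x,y)=L(x,y,\theta_m,r_m)$.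
   Context: Left turn-to-bearing path from the origin with initial heading $+x$, radius $r>0$, bearing offset $0<\theta_c<2\pi$: $H_{r,\theta_c}(d)=(r\sin(d/r),\ r(1-\cos(d/r)))$ for $0\le d\le r\theta_c$ and $H_{r,\theta_c}(d)=((d-r\theta_c)\cos\theta_c+r\sin\theta_c,\ (d-r\theta_c)\sin\theta_c+r(1-\cos\theta_c))$ for $d>r\theta_c$. $\theta_m=2\,\mathrm{atan2}(y,x)$ with $\mathrm{atan2}\in(-\pi,\pi]$ the polar angle; $r_m=(x^2+y^2)/(2y)$, defined for $y\neq0$ (conditions involving $r_m$ are understood to require $y\ne0$ unless an alternative $y=0$ is explicitly given). $R(x,y,\theta)=\dfrac{x\sin\theta-y\cos\theta}{1-\cos\theta}$. $L(x,y,\theta,r)=r\theta+\|(x,y)-r(\sin\theta,1-\cos\theta)\|$. $\Theta(x,y,r)=2\,\mathrm{atan}\!\Big(\dfrac{x-\sqrt{x^2-(2r-y)y}}{2r-y}\Big)+P(x,y,r)$ if $2r-y\ne0$; $2\,\mathrm{atan}(y/(2x))$ if $2r=y$, $x>0$; $\pi\,\mathrm{sign}(r)$ if $2r=y$, $x\le0$; here $\mathrm{atan}\in(-\pi/2,\pi/2)$, and a condition involving $\Theta(x,y,r)$ is considered false when $x^2-(2r-y)y<0$. $P(x,y,r)=0$ if $\big(0<r\land((0<x\land0<y)\lor(x\le0\land 2r<y))\big)\lor\big(r<0\land((x<0\land y<0)\lor y<2r)\big)$; $P=2\pi$ if $0<r\land((0\le x\land y<0)\lor(x<0\land y<2r))$;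 $P=-2\pi$ if $r<0\land((0\le x\land 0<y)\lor(x<0\land 2r<y))$. *)

theory Defs
  imports "HOL-Analysis.Analysis"
begin

definition turn_path :: "real \<Rightarrow> real \<Rightarrow> real \<Rightarrow> real \<times> real" where
  "turn_path r \<theta>c d =
     (if d \<le> r * \<theta>c then (r * sin (d / r), r * (1 - cos (d / r)))
      else ((d - r * \<theta>c) * cos \<theta>c + r * sin \<theta>c,
            (d - r * \<theta>c) * sin \<theta>c + r * (1 - cos \<theta>c)))"

definition path_lengths ::
    "real \<Rightarrow> real \<Rightarrow> real \<Rightarrow> real \<Rightarrow> real \<times> real \<Rightarrow> real set" where
  "path_lengths r\<alpha> r\<beta> \<theta>\<alpha> \<theta>\<beta> p =
     {d. d > 0 \<and> (\<exists>r\<in>{r\<alpha>..r\<beta>}. \<exists>\<theta>c\<in>{\<theta>\<alpha>..\<theta>\<beta>}. turn_path r \<theta>c d = p)}"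

definition reachable ::
    "real \<Rightarrow> real \<Rightarrow> real \<Rightarrow> real \<Rightarrow> real \<times> real \<Rightarrow> bool" where
  "reachable r\<alpha> r\<beta> \<theta>\<alpha> \<theta>\<beta> p \<longleftrightarrow>
     (\<exists>r\<in>{r\<alpha>..r\<beta>}. \<exists>\<theta>c\<in>{\<theta>\<alpha>..\<theta>\<beta>}. \<exists>d>0. turn_path r \<theta>c d = p)"

definition d_min ::
    "real \<Rightarrow> real \<Rightarrow> real \<Rightarrow> real \<Rightarrow> real \<times> real \<Rightarrow> real" where
  "d_min r\<alpha> r\<beta> \<theta>\<alpha> \<theta>\<beta> p = Inf (path_lengths r\<alpha> r\<beta> \<theta>\<alpha> \<theta>\<beta> p)"

text \<open>The library's \<open>Arg\<close> takes values in \<open>(-pi, pi]\<close>.\<close>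

definition atan2 :: "real \<Rightarrow> real \<Rightarrow> real" where
  "atan2 y x = Arg (Complex x y)"

definition theta_m :: "real \<Rightarrow> real \<Rightarrow> real" where
  "theta_m x y = 2 * atan2 y x"

text \<open>Meaningful only for \<open>y \<noteq> 0\<close>; conditions that use it carry that guard explicitly.\<close>

definition r_m :: "real \<Rightarrow> real \<Rightarrow> real" where
  "r_m x y = (x\<^sup>2 + y\<^sup>2) / (2 * y)"

definition turn_radius :: "real \<Rightarrow> real \<Rightarrow> real \<Rightarrow> real" where
  "turn_radius x y \<theta> = (x * sin \<theta> - y * cos \<theta>) / (1 - cos \<theta>)"

definition path_length :: "real \<Rightarrow> real \<Rightarrow> real \<Rightarrow> real \<Rightarrow> real" where
  "path_length x y \<theta> r = r * \<theta> + norm ((x, y) - r *\<^sub>R (sin \<theta>, 1 - cos \<theta>))"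

text \<open>For \<open>r < 0\<close> the cases with values \<open>0\<close> and \<open>-2 * pi\<close> overlap where
  \<open>x < 0\<close> and \<open>2 * r < y < 0\<close>; the first listed case is taken. For \<open>r > 0\<close> the cases are
  disjoint. Points covered by no case, such as \<open>x > 0\<close>, \<open>y = 0\<close>, get an unspecified value.\<close>

definition turn_offset :: "real \<Rightarrow> real \<Rightarrow> real \<Rightarrow> real" where
  "turn_offset x y r =
     (if (0 < r \<and> ((0 < x \<and> 0 < y) \<or> (x \<le> 0 \<and> 2 * r < y))) \<or>
         (r < 0 \<and> ((x < 0 \<and> y < 0) \<or> y < 2 * r)) then 0
      else if 0 < r \<and> ((0 \<le> x \<and> y < 0) \<or> (x < 0 \<and> y < 2 * r)) then 2 * pi
      else if r < 0 \<and> ((0 \<le> x \<and> 0 < y) \<or> (x < 0 \<and> 2 * r < y)) then - 2 * pi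
      else undefined)"

definition turn_angle :: "real \<Rightarrow> real \<Rightarrow> real \<Rightarrow> real" where
  "turn_angle x y r =
     (if 2 * r - y \<noteq> 0 then
        2 * arctan ((x - sqrt (x\<^sup>2 - (2 * r - y) * y)) / (2 * r - y)) + turn_offset x y r
      else if x > 0 then 2 * arctan (y / (2 * x))
      else pi * sgn r)"

text \<open>\<open>sqrt\<close> is total, so conditions on \<open>turn_angle\<close> carry the following guard,
  which makes them false when the radicand is negative.\<close>

definition turn_angle_defined :: "real \<Rightarrow> real \<Rightarrow> real \<Rightarrow> bool" where
  "turn_angle_defined x y r \<longleftrightarrow> x\<^sup>2 - (2 * r - y) * y \<ge> 0"

end

theory Submission
  imports Defs
begin

text \<open>
  Fix the target \<open>(x, y)\<close> and write \<open>c = cot (\<theta> / 2)\<close>. A path that turns through \<open>\<theta>\<close> and then runs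
  straight to the target has radius \<open>R(\<theta>) = x c - y (c\<^sup>2 - 1) / 2\<close> and straight part of (signed)
  length \<open>s(\<theta>) = y c - x\<close>; a path ending on the arc is the case \<open>s(\<theta>) = 0\<close>, with \<open>\<theta>\<close> the angle
  actually turned, which may then lie below \<open>\<theta>\<alpha>\<close>. Where \<open>s \<ge> 0\<close>, both \<open>R\<close> and the length
  \<open>D = R \<theta> + s\<close> increase with \<open>\<theta>\<close>; for \<open>D\<close> this is because, with \<open>t = \<theta> / 2\<close>, its derivative is
  \<open>s (t - sin t cos t) / sin\<^sup>2 t\<close>. So the shortest path is the one with the least admissible angle:
  the angle at which \<open>R = r\<alpha>\<close>, or \<open>\<theta>\<alpha>\<close>, or, when every admissible path is a pure arc, \<open>\<theta>\<^sub>m\<close>.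
\<close>

section \<open>Half-angle cotangent coordinates for radius and straight part\<close>

definition tail_length :: "real \<Rightarrow> real \<Rightarrow> real \<Rightarrow> real" where
  "tail_length x y \<theta> = y * cot (\<theta> / 2) - x"

text \<open>The signed tail takes the place of the norm in \<open>path_length\<close>, so that the
  length can be differentiated in \<theta>.\<close>

definition total_length :: "real \<Rightarrow> real \<Rightarrow> real \<Rightarrow> real" where
  "total_length x y \<theta> = turn_radius x y \<theta> * \<theta> + tail_length x y \<theta>"

text \<open>The rational parametrisation of the circle, with \<open>cot\<close> instead of
  \<open>tan\<close> because \<open>cot (\<theta> / 2)\<close> has no pole on (0, 2 pi).\<close>

lemma sin_cos_cot_half:
  fixes \<theta> :: real
  assumes "0 < \<theta>" "\<theta> < 2 * pi"
  shows "sin \<theta> = 2 * cot (\<theta> / 2) / (1 + (cot (\<theta> / 2))\<^sup>2)"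
    and "cos \<theta> = ((cot (\<theta> / 2))\<^sup>2 - 1) / (1 + (cot (\<theta> / 2))\<^sup>2)"
proof -
  have s: "sin (\<theta> / 2) > 0"
    using assms by (intro sin_gt_zero) auto
  have sq: "1 + (cot (\<theta> / 2))\<^sup>2 = 1 / (sin (\<theta> / 2))\<^sup>2"
    using s sin_cos_squared_add[of "\<theta> / 2"] by (simp add: cot_def field_simps)
  show "sin \<theta> = 2 * cot (\<theta> / 2) / (1 + (cot (\<theta> / 2))\<^sup>2)"
    unfolding sq using s sin_double[of "\<theta> / 2"] by (simp add: cot_def field_simps power2_eq_square)
  show "cos \<theta> = ((cot (\<theta> / 2))\<^sup>2 - 1) / (1 + (cot (\<theta> / 2))\<^sup>2)"
    unfolding sq using s cos_double[of "\<theta> / 2"] by (simp add: cot_def diff_divide_distrib power_divide algebra_simps)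
qed

lemma turn_radius_cot:
  assumes "0 < \<theta>" "\<theta> < 2 * pi"
  shows "turn_radius x y \<theta> = x * cot (\<theta> / 2) - y * ((cot (\<theta> / 2))\<^sup>2 - 1) / 2"
proof -
  define c where "c = cot (\<theta> / 2)"
  have p: "1 + c\<^sup>2 > 0" by (simp add: add_pos_nonneg)
  have "1 - cos \<theta> = 2 / (1 + c\<^sup>2)"
    using p unfolding sin_cos_cot_half[OF assms] c_def[symmetric] by (simp add: field_simps)
  moreover have "x * sin \<theta> - y * cos \<theta> = (2 * x * c - y * (c\<^sup>2 - 1)) / (1 + c\<^sup>2)"
    unfolding sin_cos_cot_half[OF assms] c_def[symmetric] by (simp add: diff_divide_distrib[symmetric])
  ultimately have "turn_radius x y \<theta> = (2 * x * c - y * (c\<^sup>2 - 1)) / 2"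
    using p unfolding turn_radius_def by simp
  then show ?thesis
    unfolding c_def by (simp add: field_simps)
qed

text \<open>Completing the square in \<open>cot (\<theta> / 2)\<close>. Geometrically, the power of
  the target with respect to the turning circle is the squared tangent length. For y \<noteq> 0 it
  recovers the radius from the tail.\<close>

lemma turn_radius_tail:
  assumes "0 < \<theta>" "\<theta> < 2 * pi"
  shows "2 * y * turn_radius x y \<theta> = x\<^sup>2 + y\<^sup>2 - (tail_length x y \<theta>)\<^sup>2"
  unfolding turn_radius_cot[OF assms] tail_length_def
  by (simp add: field_simps power2_eq_square)

text \<open>For fixed \<theta> the endpoint equations are linear in s and r, with determinant cos
  \<theta> - 1, which is nonzero on (0, 2 pi).\<close>

lemma line_point_iff:
  assumes "0 < \<theta>" "\<theta> < 2 * pi"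
  shows "(s * cos \<theta> + r * sin \<theta> = x \<and> s * sin \<theta> + r * (1 - cos \<theta>) = y)
    \<longleftrightarrow> r = turn_radius x y \<theta> \<and> s = tail_length x y \<theta>"
proof -
  define c where "c = cot (\<theta> / 2)"
  define k where "k = 1 + c\<^sup>2"
  have k: "k > 0" unfolding k_def by (simp add: add_pos_nonneg)
  have sn: "sin \<theta> = 2 * c / k" and cs: "cos \<theta> = (c\<^sup>2 - 1) / k"
    using sin_cos_cot_half[OF assms] by (auto simp: c_def k_def)
  have one: "1 - cos \<theta> = 2 / k"
    using k unfolding cs by (simp add: k_def field_simps)
  have "s * cos \<theta> + r * sin \<theta> = (s * (c\<^sup>2 - 1) + 2 * r * c) / k"
    unfolding sn cs by (simp add: add_divide_distrib[symmetric] algebra_simps)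
  moreover have "s * sin \<theta> + r * (1 - cos \<theta>) = (2 * s * c + 2 * r) / k"
    unfolding sn one by (simp add: add_divide_distrib[symmetric] algebra_simps)
  ultimately have "s * cos \<theta> + r * sin \<theta> = x \<longleftrightarrow> s * (c\<^sup>2 - 1) + 2 * r * c = x * k"
    and "s * sin \<theta> + r * (1 - cos \<theta>) = y \<longleftrightarrow> 2 * s * c + 2 * r = y * k"
    using k by (simp_all add: divide_eq_eq)
  moreover have "s * (c\<^sup>2 - 1) + 2 * r * c = x * k \<and> 2 * s * c + 2 * r = y * k
    \<longleftrightarrow> r = x * c - y * (c\<^sup>2 - 1) / 2 \<and> s = y * c - x" (is "?l \<longleftrightarrow> ?r")
  proof
    assume l: ?l
    \<comment> \<open>\<open>c\<close> times the second equation minus the first eliminates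
      \<open>r\<close>.\<close>
    then have "(y * c - x - s) * k = 0"
      unfolding k_def by algebra
    then have s: "s = y * c - x" using k by simp
    from l have "2 * (y * c - x) * c + 2 * r = y * (1 + c\<^sup>2)" unfolding s k_def by blast
    then show ?r using s by (simp add: field_simps power2_eq_square)
  next
    assume ?r
    then have rs: "r = x * c - y * (c\<^sup>2 - 1) / 2" "s = y * c - x" by blast+
    show ?l unfolding rs k_def by (simp add: field_simps power2_eq_square)
  qed
  ultimately show ?thesis
    unfolding turn_radius_cot[OF assms] tail_length_def c_def by simp
qed

lemma path_length_turn_radius:
  assumes "0 < \<theta>" "\<theta> < 2 * pi" "0 \<le> tail_length x y \<theta>"
  shows "path_length x y \<theta> (turn_radius x y \<theta>) = total_length x y \<theta>"
proof -
  have "(x, y) - turn_radius x y \<theta> *\<^sub>R (sin \<theta>, 1 - cos \<theta>)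
    = tail_length x y \<theta> *\<^sub>R (cos \<theta>, sin \<theta>)"
    using line_point_iff[OF assms(1,2), of "tail_length x y \<theta>" "turn_radius x y \<theta>" x y]
    by (simp add: algebra_simps)
  moreover have "norm (cos \<theta>, sin \<theta>) = 1" by (simp add: norm_Pair)
  ultimately show ?thesis
    unfolding path_length_def total_length_def using assms(3) by (simp del: scaleR_Pair)
qed

section \<open>Reduction to one parameter, the angle actually turned\<close>

lemma path_lengths_eq:
  assumes "0 < r\<alpha>" "0 < \<theta>\<alpha>" "\<theta>\<alpha> < \<theta>\<beta>" "\<theta>\<beta> < 2 * pi"
  shows "path_lengths r\<alpha> r\<beta> \<theta>\<alpha> \<theta>\<beta> (x, y) = total_length x y `
    {\<theta>. 0 < \<theta> \<and> \<theta> \<le> \<theta>\<beta> \<and> turn_radius x y \<theta> \<in> {r\<alpha>..r\<beta>} \<and> 0 \<le> tail_length x y \<theta>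
      \<and> (\<theta>\<alpha> \<le> \<theta> \<or> tail_length x y \<theta> = 0)}" (is "?P = total_length x y ` ?T")
proof (intro equalityI subsetI)
  fix d assume "d \<in> ?P"
  then obtain r \<theta> where d: "0 < d" and r: "r \<in> {r\<alpha>..r\<beta>}" and \<theta>: "\<theta> \<in> {\<theta>\<alpha>..\<theta>\<beta>}"
    and eq: "turn_path r \<theta> d = (x, y)"
    unfolding path_lengths_def by auto
  have "r > 0" using r assms(1) by auto
  show "d \<in> total_length x y ` ?T"
  proof (cases "d \<le> r * \<theta>")
    case True
    \<comment> \<open>The target lies on the arc, so the angle turned is \<open>d / r\<close>, not
      the bearing offset.\<close>
    have \<phi>: "0 < d / r" "d / r \<le> \<theta>" using True d \<open>r > 0\<close> by (auto simp: field_simps)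
    then have "r = turn_radius x y (d / r) \<and> 0 = tail_length x y (d / r)"
      using eq True \<theta> assms by (subst line_point_iff[symmetric]) (auto simp: turn_path_def)
    moreover from this have "d = total_length x y (d / r)"
      using \<open>r > 0\<close> unfolding total_length_def by (metis add.right_neutral less_irrefl nonzero_eq_divide_eq mult.commute)
    ultimately show ?thesis using \<phi> \<theta> r by (intro image_eqI[of _ _ "d / r"]) auto
  next
    case False
    then have "r = turn_radius x y \<theta> \<and> d - r * \<theta> = tail_length x y \<theta>"
      using eq \<theta> assms by (subst line_point_iff[symmetric]) (auto simp: turn_path_def)
    moreover from this have "d = total_length x y \<theta>" unfolding total_length_def by auto
    ultimately show ?thesis using False \<theta> r assms by (intro image_eqI[of _ _ \<theta>]) auto
  qed
next
  fix d assume "d \<in> total_length x y ` ?T"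
  then obtain \<theta> where d: "d = total_length x y \<theta>" and \<theta>: "\<theta> \<in> ?T" by auto
  define r where "r = turn_radius x y \<theta>"
  define s where "s = tail_length x y \<theta>"
  have r: "r \<in> {r\<alpha>..r\<beta>}" "r > 0" using \<theta> assms by (auto simp: r_def)
  have "0 < \<theta>" "\<theta> < 2 * pi" and s: "0 \<le> s" using \<theta> assms by (auto simp: s_def)
  then have pt: "s * cos \<theta> + r * sin \<theta> = x \<and> s * sin \<theta> + r * (1 - cos \<theta>) = y"
    by (subst line_point_iff) (auto simp: r_def s_def)
  have ds: "d = r * \<theta> + s" by (simp add: d total_length_def r_def s_def)
  \<comment> \<open>If the tail vanishes, any bearing offset of at least \<theta> passes through the
    target at the same length, so the offset can be raised to \<theta>\<alpha>; otherwise the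
    maximum is \<theta> itself.\<close>
  have "turn_path r (max \<theta>\<alpha> \<theta>) d = (x, y)"
  proof (cases "s = 0")
    case True
    then show ?thesis using pt ds r by (auto simp: turn_path_def mult_left_mono)
  next
    case False
    then have "\<theta>\<alpha> \<le> \<theta>" using \<theta> by (auto simp: s_def)
    then show ?thesis using False s pt ds by (auto simp: turn_path_def max_def)
  qed
  moreover have "d > 0" using ds s r \<open>0 < \<theta>\<close> by (simp add: add_pos_nonneg)
  ultimately show "d \<in> ?P"
    unfolding path_lengths_def using r(1) \<theta> assms(3)
    by (auto intro!: bexI[of _ r, OF bexI[of _ "max \<theta>\<alpha> \<theta>"]])
qed

section \<open>Monotonicity of tail, radius and length in the angle\<close>

lemma cot_strict_antimono:
  fixes s t :: real
  assumes "0 < s" "s < t" "t < pi"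
  shows "cot t < cot s"
proof -
  have "sin s > 0" "sin t > 0" "sin (t - s) > 0" using assms by (auto intro!: sin_gt_zero)
  then show ?thesis by (auto simp: cot_def sin_diff field_simps)
qed

lemma tail_length_strict_antimono:
  assumes "0 < \<theta>1" "\<theta>1 < \<theta>2" "\<theta>2 < 2 * pi" "0 < y"
  shows "tail_length x y \<theta>2 < tail_length x y \<theta>1"
  using assms cot_strict_antimono[of "\<theta>1 / 2" "\<theta>2 / 2"] by (simp add: tail_length_def)

text \<open>The tail is affine in the monotone \<open>cot (\<theta> / 2)\<close>, hence monotone in
  \<theta>, in a direction set by the sign of y.\<close>

lemma tail_length_between:
  assumes "0 < \<theta>1" "\<theta>1 \<le> \<theta>" "\<theta> \<le> \<theta>2" "\<theta>2 < 2 * pi"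
    and "0 \<le> tail_length x y \<theta>1" "0 \<le> tail_length x y \<theta>2"
  shows "0 \<le> tail_length x y \<theta>"
proof -
  have "cot (\<theta> / 2) \<le> cot (\<theta>1 / 2)"
    using assms cot_strict_antimono[of "\<theta>1 / 2" "\<theta> / 2"] by (cases "\<theta> = \<theta>1") auto
  moreover have "cot (\<theta>2 / 2) \<le> cot (\<theta> / 2)"
    using assms cot_strict_antimono[of "\<theta> / 2" "\<theta>2 / 2"] by (cases "\<theta> = \<theta>2") auto
  ultimately show ?thesis
    using assms(5,6) unfolding tail_length_def
    by (cases "y \<ge> 0") (smt (verit) mult_left_mono, smt (verit) mult_left_mono_neg)
qed

lemma turn_radius_strict_mono:
  assumes "0 < \<theta>1" "\<theta>1 < \<theta>2" "\<theta>2 < 2 * pi"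
    and "0 \<le> tail_length x y \<theta>1" "0 \<le> tail_length x y \<theta>2" "(x, y) \<noteq> (0, 0)"
  shows "turn_radius x y \<theta>1 < turn_radius x y \<theta>2"
proof -
  let ?c1 = "cot (\<theta>1 / 2)" and ?c2 = "cot (\<theta>2 / 2)"
  have c: "?c2 < ?c1" using assms by (intro cot_strict_antimono) auto
  \<comment> \<open>The radius is quadratic in the cotangent, so its increment factors exactly, and
    signs at the two endpoints suffice.\<close>
  have "turn_radius x y \<theta>2 - turn_radius x y \<theta>1
    = (?c1 - ?c2) * (tail_length x y \<theta>1 + tail_length x y \<theta>2) / 2"
    using assms by (simp add: turn_radius_cot tail_length_def field_simps power2_eq_square)
  moreover have "tail_length x y \<theta>1 + tail_length x y \<theta>2 \<noteq> 0"
  proof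
    assume "tail_length x y \<theta>1 + tail_length x y \<theta>2 = 0"
    then have "y * ?c1 = x" "y * ?c2 = x" using assms by (auto simp: tail_length_def)
    then show False using c assms(6) by auto
  qed
  then have "0 < (?c1 - ?c2) * (tail_length x y \<theta>1 + tail_length x y \<theta>2)"
    using c assms(4,5) by (intro mult_pos_pos) auto
  ultimately show ?thesis by simp
qed

lemma total_length_mono:
  assumes "0 < \<theta>1" "\<theta>1 \<le> \<theta>2" "\<theta>2 < 2 * pi"
    and "0 \<le> tail_length x y \<theta>1" "0 \<le> tail_length x y \<theta>2"
  shows "total_length x y \<theta>1 \<le> total_length x y \<theta>2"
proof -
  \<comment> \<open>The closed form in \<open>cot\<close> avoids differentiating the quotient by 1 -
    cos \<theta>.\<close>
  define f where "f = (\<lambda>\<theta>. (x * cot (\<theta> / 2) - y * ((cot (\<theta> / 2))\<^sup>2 - 1) / 2) * \<theta> + (y * cot (\<theta> / 2) - x))"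
  have "f \<theta>1 \<le> f \<theta>2"
  proof (rule DERIV_nonneg_imp_nondecreasing[OF assms(2)])
    fix \<theta> assume \<theta>: "\<theta>1 \<le> \<theta>" "\<theta> \<le> \<theta>2"
    define t where "t = \<theta> / 2"
    have t: "0 < t" "t < pi" using \<theta> assms by (auto simp: t_def)
    then have sn: "sin t > 0" by (simp add: sin_gt_zero)
    have "(f has_real_derivative
      ((x * (- inverse ((sin t)\<^sup>2) / 2) - y * (2 * cot t * (- inverse ((sin t)\<^sup>2) / 2)) / 2) * \<theta>
       + (x * cot t - y * ((cot t)\<^sup>2 - 1) / 2) + y * (- inverse ((sin t)\<^sup>2) / 2))) (at \<theta>)"
      unfolding f_def t_def using sn
      by (auto intro!: derivative_eq_intros DERIV_cot[THEN DERIV_chain2] simp: t_def mult.commute)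
    also have "((x * (- inverse ((sin t)\<^sup>2) / 2) - y * (2 * cot t * (- inverse ((sin t)\<^sup>2) / 2)) / 2) * \<theta>
       + (x * cot t - y * ((cot t)\<^sup>2 - 1) / 2) + y * (- inverse ((sin t)\<^sup>2) / 2))
       = tail_length x y \<theta> * (t - sin t * cos t) / (sin t)\<^sup>2" (is "?l = ?r")
    proof -
      have i: "inverse ((sin t)\<^sup>2) = 1 + (cot t)\<^sup>2"
        using sn sin_cos_squared_add[of t] by (simp add: cot_def field_simps)
      have "(t - sin t * cos t) / (sin t)\<^sup>2 = t * inverse ((sin t)\<^sup>2) - cot t"
        using sn by (simp add: cot_def power2_eq_square divide_inverse algebra_simps)
      then have "?r = tail_length x y \<theta> * (t * inverse ((sin t)\<^sup>2) - cot t)"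
        by (simp only: times_divide_eq_right[symmetric])
      also have "\<dots> = ?l" unfolding i tail_length_def
        by (simp add: t_def field_simps power2_eq_square)
      finally show ?thesis by simp
    qed
    finally have "(f has_real_derivative tail_length x y \<theta> * (t - sin t * cos t) / (sin t)\<^sup>2) (at \<theta>)" .
    moreover have "sin t * cos t \<le> t"
    proof -
      have "sin t * cos t \<le> sin t * 1" using sn by (intro mult_left_mono) auto
      then show ?thesis using sin_x_le_x[of t] t by simp
    qed
    moreover have "0 \<le> tail_length x y \<theta>"
      using tail_length_between[OF assms(1) \<theta> assms(3-5)] .
    ultimately show "\<exists>z. (f has_real_derivative z) (at \<theta>) \<and> 0 \<le> z"
      by (intro exI[of _ "tail_length x y \<theta> * (t - sin t * cos t) / (sin t)\<^sup>2"] conjI) auto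
  qed
  then show ?thesis
    using assms by (simp add: f_def total_length_def tail_length_def turn_radius_cot)
qed

section \<open>The two critical angles\<close>

text \<open>The chord of an arc makes half the turned angle with the initial tangent, so the pure
  arc to the target turns by twice its polar angle.\<close>

lemma theta_m_half_turn:
  assumes "0 < y"
  shows "0 < theta_m x y" "theta_m x y < 2 * pi" "tail_length x y (theta_m x y) = 0"
    "turn_radius x y (theta_m x y) = r_m x y"
proof -
  define a where "a = Arg (Complex x y)"
  have nz: "Complex x y \<noteq> 0" using assms by (auto simp: complex_eq_iff)
  have a: "0 < a" "a < pi"
    using assms Arg_lt_pi[of "Complex x y"] unfolding a_def by auto
  show b: "0 < theta_m x y" "theta_m x y < 2 * pi"
    using a by (auto simp: theta_m_def atan2_def a_def)
  have "Complex x y = rcis (cmod (Complex x y)) a" unfolding a_def by (simp add: rcis_cmod_Arg)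
  then have "x = cmod (Complex x y) * cos a" "y = cmod (Complex x y) * sin a"
    by (metis Re_rcis complex.sel(1), metis Im_rcis complex.sel(2))
  moreover have "sin a > 0" using a by (simp add: sin_gt_zero)
  ultimately have "y * cot a = x" unfolding cot_def
    by (metis less_irrefl mult.assoc nonzero_mult_div_cancel_left mult.commute times_divide_eq_right)
  then show t: "tail_length x y (theta_m x y) = 0"
    by (simp add: tail_length_def theta_m_def atan2_def a_def)
  show "turn_radius x y (theta_m x y) = r_m x y"
    using turn_radius_tail[OF b, of y x] t assms by (simp add: r_m_def field_simps)
qed


text \<open>At radius r the squared tail must be the radicand; \<Theta> selects its nonnegative root
  \<sigma>, that is y cot(\<Theta>/2) = x + \<sigma>. The last hypothesis excludes the ray y = 0, x
  \<ge> 0, where \<open>turn_offset\<close> is unspecified.\<close>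

lemma turn_angle_half_turn:
  assumes "0 < r" "turn_angle_defined x y r" "y \<noteq> 0 \<or> x < 0"
  shows "0 < turn_angle x y r" "turn_angle x y r < 2 * pi"
    "0 \<le> tail_length x y (turn_angle x y r)" "turn_radius x y (turn_angle x y r) = r"
proof -
  define \<sigma> where "\<sigma> = sqrt (x\<^sup>2 - (2 * r - y) * y)"
  define \<Theta> where "\<Theta> = turn_angle x y r"
  have \<sigma>: "0 \<le> \<sigma>" "\<sigma>\<^sup>2 = x\<^sup>2 - (2 * r - y) * y"
    using assms(2) by (auto simp: \<sigma>_def turn_angle_defined_def)
  define u where "u = (x - \<sigma>) / (2 * r - y)"
  \<comment> \<open>For y = 0 the tail does not determine the radius, hence the separate last
    conjunct.\<close>
  have "0 < \<Theta> \<and> \<Theta> < 2 * pi \<and> y * cot (\<Theta> / 2) = x + \<sigma> \<and> (y = 0 \<longrightarrow> x * cot (\<Theta> / 2) = r)"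
  proof (cases "2 * r - y = 0")
    case True
    then have y: "y = 2 * r" by simp
    have "\<sigma> = \<bar>x\<bar>" by (simp add: \<sigma>_def True)
    show ?thesis
    proof (cases "x > 0")
      case True
      then have "\<Theta> = 2 * arctan (y / (2 * x))" by (simp add: \<Theta>_def turn_angle_def y)
      moreover have "0 < y / (2 * x)" using True y assms(1) by simp
      ultimately show ?thesis
        using arctan_ubound[of "y / (2 * x)"] True y assms(1) \<open>\<sigma> = \<bar>x\<bar>\<close>
        by (auto simp: cot_altdef tan_arctan intro: less_trans[of _ "pi / 2"])
    next
      case False
      then have "\<Theta> = pi" using assms(1) by (simp add: \<Theta>_def turn_angle_def y)
      then show ?thesis using False y assms(1) \<open>\<sigma> = \<bar>x\<bar>\<close> by (simp add: cot_def)
    qed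
  next
    case False
    \<comment> \<open>Rationalising: (x - \<sigma>)(x + \<sigma>) = (2r - y) y.\<close>
    have prod: "u * (x + \<sigma>) = y"
      using False \<sigma>(2) by (simp add: u_def field_simps power2_eq_square)
    have \<Theta>: "\<Theta> = 2 * arctan u + turn_offset x y r"
      using False by (simp add: \<Theta>_def turn_angle_def u_def \<sigma>_def)
    have "(0 < u \<and> turn_offset x y r = 0) \<or> (u < 0 \<and> turn_offset x y r = 2 * pi)"
    proof -
      \<comment> \<open>The sign of \<open>u\<close> is constant on each region. In the first one 2r
        - y may have either sign, so the sign comes from \<open>prod\<close>; elsewhere it is read
        off the quotient.\<close>
      consider "0 < x" "0 < y" | "x \<le> 0" "2 * r < y" | "x \<le> 0" "0 < y" "y < 2 * r"
        | "y \<le> 0" "x < 0" | "y < 0" "0 \<le> x"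
        using assms(3) False by linarith
      then show ?thesis
      proof cases
        case 1
        then have "0 < x + \<sigma>" using \<sigma>(1) by simp
        then have "0 < u" using prod 1 by (metis zero_less_mult_pos2)
        then show ?thesis using 1 assms(1) by (simp add: turn_offset_def)
      next
        case 2
        then have "(2 * r - y) * y < 0" using assms(1) by (intro mult_neg_pos) auto
        then have "\<sigma>\<^sup>2 > 0" using \<sigma>(2) zero_le_power2[of x] by linarith
        then have "0 < \<sigma>" using \<sigma>(1) by (simp add: zero_less_power2)
        then have "0 < u" using 2 by (simp add: u_def divide_neg_neg)
        then show ?thesis using 2 assms(1) by (simp add: turn_offset_def)
      next
        case 3
        then have "(2 * r - y) * y > 0" by simp
        then have "\<sigma>\<^sup>2 < x\<^sup>2" using \<sigma>(2) by simp
        then have "\<sigma> < - x" using 3 power2_less_imp_less[of \<sigma> "- x"] by simp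
        then have "u < 0" using 3 \<sigma>(1) by (simp add: u_def divide_neg_pos)
        then show ?thesis using 3 assms(1) \<open>\<sigma> < - x\<close> \<sigma>(1) by (simp add: turn_offset_def)
      next
        case 4
        then have "u < 0" using assms(1) \<sigma>(1) by (simp add: u_def divide_neg_pos)
        then show ?thesis using 4 assms(1) by (simp add: turn_offset_def)
      next
        case 5
        then have "\<sigma>\<^sup>2 > x\<^sup>2" using \<sigma>(2) assms(1) mult_pos_neg[of "2 * r - y" y] by simp
        then have "x < \<sigma>" using \<sigma>(1) power2_less_imp_less by blast
        then have "u < 0" using assms(1) 5 by (simp add: u_def divide_neg_pos)
        then show ?thesis using 5 assms(1) by (simp add: turn_offset_def)
      qed
    qed
    \<comment> \<open>The offset 2 pi shifts \<Theta>/2 by one period of \<open>tan\<close>, which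
      brings a negative \<open>arctan u\<close> into (0, pi).\<close>
    then have "0 < \<Theta> \<and> \<Theta> < 2 * pi" and "u \<noteq> 0"
      and t: "tan (\<Theta> / 2) = u"
      using arctan_bounded[of u] tan_periodic_pi[of "arctan u"] unfolding \<Theta> 
      by (auto simp: tan_arctan add_divide_distrib)
    moreover have "y * cot (\<Theta> / 2) = x + \<sigma>"
      using prod \<open>u \<noteq> 0\<close> by (simp add: cot_altdef t field_simps)
    moreover have "x * cot (\<Theta> / 2) = r" if "y = 0"
    proof -
      have "\<sigma> = - x" using that assms(3) by (simp add: \<sigma>_def)
      then show ?thesis using that assms by (simp add: cot_altdef t u_def)
    qed
    ultimately show ?thesis by blast
  qed
  then have b: "0 < \<Theta>" "\<Theta> < 2 * pi" and t: "tail_length x y \<Theta> = \<sigma>"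
    and z: "y = 0 \<Longrightarrow> x * cot (\<Theta> / 2) = r"
    by (auto simp: tail_length_def)
  show "0 < turn_angle x y r" "turn_angle x y r < 2 * pi" "0 \<le> tail_length x y (turn_angle x y r)"
    using b t \<sigma>(1) by (simp_all add: \<Theta>_def)
  have "turn_radius x y \<Theta> = r"
  proof (cases "y = 0")
    case True
    then show ?thesis using z b by (simp add: turn_radius_cot)
  next
    case False
    have "2 * y * turn_radius x y \<Theta> = 2 * y * r"
      unfolding turn_radius_tail[OF b] t \<sigma>(2) by (simp add: algebra_simps power2_eq_square)
    then show ?thesis using False by simp
  qed
  then show "turn_radius x y (turn_angle x y r) = r" by (simp add: \<Theta>_def)
qed

section \<open>The least admissible angle in each of the three cases\<close>

theorem theorem9:
  fixes r\<alpha> r\<beta> \<theta>\<alpha> \<theta>\<beta> x y :: real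
  assumes "0 < r\<alpha>" and "r\<alpha> \<le> r\<beta>"
    and "0 < \<theta>\<alpha>" and "\<theta>\<alpha> < \<theta>\<beta>" and "\<theta>\<beta> < 2 * pi"
    and "(x, y) \<noteq> (0, 0)"
    and "reachable r\<alpha> r\<beta> \<theta>\<alpha> \<theta>\<beta> (x, y)"
  shows
    "(turn_angle_defined x y r\<alpha> \<and>
        \<theta>\<alpha> \<le> turn_angle x y r\<alpha> \<and> turn_angle x y r\<alpha> \<le> \<theta>\<beta> \<longrightarrow>
      d_min r\<alpha> r\<beta> \<theta>\<alpha> \<theta>\<beta> (x, y) = path_length x y (turn_angle x y r\<alpha>) r\<alpha>) \<and>
     (((x\<^sup>2 + y\<^sup>2 > 2 * r\<alpha> * y \<and> 0 \<le> y \<and>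
          ((y \<noteq> 0 \<and> r\<alpha> \<le> r_m x y) \<or> y = 0) \<and> \<theta>\<alpha> < theta_m x y) \<or>
         (y < 0 \<and> theta_m x y < 0)) \<and>
        turn_angle_defined x y r\<alpha> \<and> turn_angle x y r\<alpha> < \<theta>\<alpha> \<longrightarrow>
      d_min r\<alpha> r\<beta> \<theta>\<alpha> \<theta>\<beta> (x, y) = path_length x y \<theta>\<alpha> (turn_radius x y \<theta>\<alpha>)) \<and>
     (y \<noteq> 0 \<and> r\<alpha> \<le> r_m x y \<and> r_m x y \<le> r\<beta> \<and>
        turn_angle_defined x y r\<alpha> \<and> theta_m x y \<le> max \<theta>\<alpha> (turn_angle x y r\<alpha>) \<longrightarrow>
      d_min r\<alpha> r\<beta> \<theta>\<alpha> \<theta>\<beta> (x, y) = path_length x y (theta_m x y) (r_m x y))"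
proof -
  define T where "T = {\<theta>. 0 < \<theta> \<and> \<theta> \<le> \<theta>\<beta> \<and> turn_radius x y \<theta> \<in> {r\<alpha>..r\<beta>}
    \<and> 0 \<le> tail_length x y \<theta> \<and> (\<theta>\<alpha> \<le> \<theta> \<or> tail_length x y \<theta> = 0)}"
  define \<Theta> where "\<Theta> = turn_angle x y r\<alpha>"
  have lengths: "path_lengths r\<alpha> r\<beta> \<theta>\<alpha> \<theta>\<beta> (x, y) = total_length x y ` T"
    unfolding T_def by (rule path_lengths_eq[OF assms(1,3,4,5)])
  moreover have "path_lengths r\<alpha> r\<beta> \<theta>\<alpha> \<theta>\<beta> (x, y) \<noteq> {}"
    using assms(7) by (auto simp: reachable_def path_lengths_def)
  ultimately obtain \<theta>0 where \<theta>0: "\<theta>0 \<in> T" by auto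
  \<comment> \<open>Length is monotone on \<open>T\<close>, so a least element of \<open>T\<close>
    attains the infimum.\<close>
  have d_min: "d_min r\<alpha> r\<beta> \<theta>\<alpha> \<theta>\<beta> (x, y) = path_length x y \<theta> (turn_radius x y \<theta>)"
    if "\<theta> \<in> T" "\<And>\<phi>. \<phi> \<in> T \<Longrightarrow> \<theta> \<le> \<phi>" for \<theta>
  proof -
    have "Inf (total_length x y ` T) = total_length x y \<theta>"
      using that assms(5) by (intro cInf_eq_minimum) (auto simp: T_def intro!: total_length_mono)
    then show ?thesis
      unfolding d_min_def lengths using that(1) assms(5) by (subst path_length_turn_radius) (auto simp: T_def)
  qed
  \<comment> \<open>For y = 0 the tail is -x, and a reachable target has a nonnegative tail.\<close>
  have "y \<noteq> 0 \<or> x < 0"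
    using \<theta>0 assms(6) by (auto simp: T_def tail_length_def)
  then have \<Theta>: "0 < \<Theta>" "\<Theta> < 2 * pi" "0 \<le> tail_length x y \<Theta>" "turn_radius x y \<Theta> = r\<alpha>"
    if "turn_angle_defined x y r\<alpha>"
    using turn_angle_half_turn[OF assms(1) that] by (auto simp: \<Theta>_def)
  \<comment> \<open>An admissible angle below \<Theta> would have radius below r\<alpha>.\<close>
  have \<Theta>_le: "\<Theta> \<le> \<phi>" if "turn_angle_defined x y r\<alpha>" "\<phi> \<in> T" for \<phi>
    using turn_radius_strict_mono[of \<phi> \<Theta> x y] \<Theta>[OF that(1)] that(2) assms(5,6)
    by (force simp: T_def)
  show ?thesis
  proof (intro conjI impI, goal_cases)
    case 1
    then have d: "turn_angle_defined x y r\<alpha>" and "\<theta>\<alpha> \<le> \<Theta>" "\<Theta> \<le> \<theta>\<beta>" by (auto simp: \<Theta>_def)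
    then have "\<Theta> \<in> T" using \<Theta>[OF d] assms(2) by (auto simp: T_def)
    then show ?case using d_min \<Theta>_le[OF d] \<Theta>(4)[OF d] unfolding \<Theta>_def by metis
  next
    case 2
    then have d: "turn_angle_defined x y r\<alpha>" and less: "\<Theta> < \<theta>\<alpha>" by (auto simp: \<Theta>_def)
    note \<Theta> = \<Theta>[OF d]
    \<comment> \<open>For y > 0, \<theta>\<alpha> lies between \<Theta> and the zero
      \<open>theta_m x y\<close> of the tail; for y = 0 the tail is constant, and for y < 0 it
      increases from \<Theta> on.\<close>
    have tail: "0 \<le> tail_length x y \<theta>\<alpha>"
    proof -
      consider "0 < y" "\<theta>\<alpha> < theta_m x y" | "y = 0" | "y < 0" using 2 by linarith
      then show ?thesis
      proof cases
        case 1
        then show ?thesis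
          using tail_length_between[of \<Theta> \<theta>\<alpha> "theta_m x y" x y] \<Theta> less theta_m_half_turn[OF 1(1), of x] by simp
      next
        case 2
        then show ?thesis using \<Theta>(3) by (simp add: tail_length_def)
      next
        case 3
        have "cot (\<theta>\<alpha> / 2) < cot (\<Theta> / 2)" using less \<Theta>(1) assms by (intro cot_strict_antimono) auto
        then have "y * cot (\<Theta> / 2) < y * cot (\<theta>\<alpha> / 2)" using 3 by simp
        then show ?thesis using \<Theta>(3) by (simp add: tail_length_def)
      qed
    qed
    \<comment> \<open>An admissible angle below \<theta>\<alpha> belongs to a pure arc. Its positive
      radius forces y > 0, so the tail decreases and would be negative at \<theta>\<alpha>.\<close>
    have le: "\<theta>\<alpha> \<le> \<phi>" if "\<phi> \<in> T" for \<phi>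
    proof (rule ccontr)
      assume "\<not> \<theta>\<alpha> \<le> \<phi>"
      then have \<phi>: "0 < \<phi>" "\<phi> < \<theta>\<alpha>" "tail_length x y \<phi> = 0" "r\<alpha> \<le> turn_radius x y \<phi>"
        using that by (auto simp: T_def)
      have "0 < 2 * y * turn_radius x y \<phi>"
        using turn_radius_tail[of \<phi> y x] \<phi> assms(4,5,6) by (simp add: sum_power2_gt_zero_iff)
      then have "0 < y" using \<phi>(4) assms(1) by (simp add: zero_less_mult_iff)
      have "tail_length x y \<theta>\<alpha> < tail_length x y \<phi>"
        using \<phi> \<open>0 < y\<close> assms by (intro tail_length_strict_antimono) auto
      then show False using tail \<phi>(3) by simp
    qed
    have "r\<alpha> < turn_radius x y \<theta>\<alpha>"
      using turn_radius_strict_mono[of \<Theta> \<theta>\<alpha> x y] \<Theta> less tail assms by simp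
    \<comment> \<open>The upper bound is inherited from the angle \<theta>0 \<ge> \<theta>\<alpha>
      supplied by reachability.\<close>
    moreover have "turn_radius x y \<theta>\<alpha> \<le> r\<beta>"
      using turn_radius_strict_mono[of \<theta>\<alpha> \<theta>0 x y] le[OF \<theta>0] \<theta>0 tail assms
      by (cases "\<theta>\<alpha> = \<theta>0") (auto simp: T_def)
    ultimately have "\<theta>\<alpha> \<in> T" using tail assms by (auto simp: T_def)
    then show ?case using d_min le by blast
  next
    case 3
    then have d: "turn_angle_defined x y r\<alpha>" and max: "theta_m x y \<le> max \<theta>\<alpha> \<Theta>" by (auto simp: \<Theta>_def)
    have "0 < r_m x y" using 3 assms(1) by linarith
    then have y: "0 < y" using assms(6) by (auto simp: r_m_def zero_less_divide_iff not_sum_power2_lt_zero)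
    note m = theta_m_half_turn[OF y, of x]
    \<comment> \<open>For y > 0 a nonnegative tail gives \<phi> \<le> \<open>theta_m x y\<close>.
      Conversely, \<phi> either has zero tail, which occurs only there, or is at least both
      \<theta>\<alpha> and \<Theta>.\<close>
    have eq: "\<phi> = theta_m x y" if "\<phi> \<in> T" for \<phi>
    proof -
      have \<phi>: "0 < \<phi>" "\<phi> < 2 * pi" "0 \<le> tail_length x y \<phi>" using that assms(5) by (auto simp: T_def)
      have le: "\<phi> \<le> theta_m x y"
        using tail_length_strict_antimono[of "theta_m x y" \<phi> y x] m \<phi> y by force
      have "\<not> \<phi> < theta_m x y" if "tail_length x y \<phi> = 0"
        using tail_length_strict_antimono[of \<phi> "theta_m x y" y x] m \<phi> y that by force
      then show ?thesis using le max \<Theta>_le[OF d that] that by (auto simp: T_def max_def split: if_splits)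
    qed
    \<comment> \<open>\<open>T\<close> is nonempty and has no other element, so membership needs no
      check of the bounds.\<close>
    then have "theta_m x y \<in> T" using \<theta>0 by blast
    then show ?case using d_min eq m(4) by (metis order_refl)
  qed
qed

end
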